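(* If $\mathfrak{g}$ is an exceptional simple Lie algebra over $\mathbb{C}$ (type $G_2$, $F_4$, $E_6$, $E_7$ or $E_8$) and $\tilde{\alpha}$ is the sum of its simple roots, then $\mathcal{CA}(\tilde{\alpha},0)=\emptyset$.
   Context: Let $W$ be the Weyl group of $\mathfrak{g}$, generated by the simple reflections $s_i$, and $\rho$ half the sum of the positive roots. Kostant's partition function $\wp(\xi)$ is the number of ways to write $\xi\in\mathfrak{h}^*$ as a nonnegative integral sum of positive roots. For integral weights $\lambda,\mu$, the Weyl alternation set is $\mathcal{A}(\lambda,\mu)=\{\sigma\in W:\wp(\sigma(\lambda+\rho)-(\mu+\rho))>0\}$, and the collapsed Weyl alternation set is $$\mathcal{CA}(\lambda,\mu)=\{\sigma\in\mathcal{A}(\lambda,\mu): \text{there is no simple reflection } s_i\in W \text{ with } \wp(\sigma(\lambda+\rho)-\rho-\mu)=\wp(\sigma s_i(\lambda+\rho)-\rho-\mu)\}.$$ *)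

theory Defs
  imports
    Complex_Main
    "HOL-Library.Function_Algebras"
    "HOL-Algebra.Bij"
    "HOL-Algebra.Generated_Groups"
begin

section \<open>Complex Lie algebras\<close>

text \<open>The underlying vector space is the whole type \<open>'g\<close>.\<close>

locale lie_algebra = vector_space scale
  for scale :: "complex \<Rightarrow> 'g::ab_group_add \<Rightarrow> 'g" +
  fixes bracket :: "'g \<Rightarrow> 'g \<Rightarrow> 'g"
  assumes linear_right: "Vector_Spaces.linear scale scale (\<lambda>y. bracket x y)"
    and linear_left: "Vector_Spaces.linear scale scale (\<lambda>x. bracket x y)"
    and alternating: "bracket x x = 0"
    and jacobi: "bracket x (bracket y z) + bracket y (bracket z x) + bracket z (bracket x y) = 0"
begin

definition lie_ideal :: "'g set \<Rightarrow> bool" where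
  "lie_ideal I \<longleftrightarrow> subspace I \<and> (\<forall>x. \<forall>y\<in>I. bracket x y \<in> I)"

end

locale simple_lie_algebra = lie_algebra +
  assumes finite_dimensional: "\<exists>B. finite B \<and> span B = UNIV"
    and nonabelian: "\<exists>x y. bracket x y \<noteq> 0"
    and only_trivial_ideals: "lie_ideal I \<Longrightarrow> I = {0} \<or> I = UNIV"


section \<open>Cartan subalgebras, roots and bases\<close>

context lie_algebra
begin

text \<open>
  In a semisimple complex Lie algebra the Cartan subalgebras are the maximal abelian
  subalgebras all of whose elements are ad-diagonalizable.
\<close>

definition ad_diagonalizable :: "'g \<Rightarrow> bool" where
  "ad_diagonalizable h \<longleftrightarrow> span {x. \<exists>c. bracket h x = scale c x} = UNIV"

definition cartan_subalgebra :: "'g set \<Rightarrow> bool" where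
  "cartan_subalgebra H \<longleftrightarrow>
     subspace H \<and>
     (\<forall>h\<in>H. \<forall>h'\<in>H. bracket h h' = 0) \<and>
     (\<forall>x. (\<forall>h\<in>H. bracket h x = 0) \<longrightarrow> x \<in> H) \<and>
     (\<forall>h\<in>H. ad_diagonalizable h)"

text \<open>
  The dual space of \<open>H\<close>: a linear functional on \<open>H\<close> is represented by the function on
  \<open>'g\<close> extending it by \<open>0\<close> outside \<open>H\<close> (an extension that is in general not linear on
  \<open>'g\<close>), so that equality of functionals is equality of functions and the vector space
  operations are pointwise.
\<close>

definition dual :: "'g set \<Rightarrow> ('g \<Rightarrow> complex) set" where
  "dual H = {f. (\<forall>x\<in>H. \<forall>y\<in>H. f (x + y) = f x + f y) \<and>
                (\<forall>c. \<forall>x\<in>H. f (scale c x) = c * f x) \<and>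
                (\<forall>x. x \<notin> H \<longrightarrow> f x = 0)}"

definition root_space :: "'g set \<Rightarrow> ('g \<Rightarrow> complex) \<Rightarrow> 'g set" where
  "root_space H \<alpha> = {x. \<forall>h\<in>H. bracket h x = scale (\<alpha> h) x}"

definition roots :: "'g set \<Rightarrow> ('g \<Rightarrow> complex) set" where
  "roots H = {\<alpha> \<in> dual H. \<alpha> \<noteq> 0 \<and> root_space H \<alpha> \<noteq> {0}}"

text \<open>
  The coroot of \<open>\<alpha>\<close> is the unique element of \<open>[\<gg>\<^sub>\<alpha>, \<gg>\<^bsub>-\<alpha>\<^esub>]\<close> on
  which \<open>\<alpha>\<close> takes the value \<open>2\<close>.
\<close>

definition coroot :: "'g set \<Rightarrow> ('g \<Rightarrow> complex) \<Rightarrow> 'g" where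
  "coroot H \<alpha> =
     (THE h. h \<in> span {bracket x y | x y. x \<in> root_space H \<alpha> \<and> y \<in> root_space H (- \<alpha>)} \<and>
             \<alpha> h = 2)"

definition nonneg_combination :: "('g \<Rightarrow> complex) set \<Rightarrow> ('g \<Rightarrow> complex) \<Rightarrow> bool" where
  "nonneg_combination \<Delta> \<beta> \<longleftrightarrow> (\<exists>k :: ('g \<Rightarrow> complex) \<Rightarrow> nat. \<forall>x. \<beta> x = (\<Sum>\<alpha>\<in>\<Delta>. of_nat (k \<alpha>) * \<alpha> x))"

definition root_base :: "'g set \<Rightarrow> ('g \<Rightarrow> complex) set \<Rightarrow> bool" where
  "root_base H \<Delta> \<longleftrightarrow>
     finite \<Delta> \<and> \<Delta> \<subseteq> roots H \<and>
     \<not> module.dependent (\<lambda>(c::complex) f x. c * f x) \<Delta> \<and>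
     module.span (\<lambda>(c::complex) f x. c * f x) \<Delta> = dual H \<and>
     (\<forall>\<beta>\<in>roots H. nonneg_combination \<Delta> \<beta> \<or> nonneg_combination \<Delta> (- \<beta>))"

definition positive_roots :: "'g set \<Rightarrow> ('g \<Rightarrow> complex) set \<Rightarrow> ('g \<Rightarrow> complex) set" where
  "positive_roots H \<Delta> = {\<beta> \<in> roots H. nonneg_combination \<Delta> \<beta>}"

definition half_sum :: "'g set \<Rightarrow> ('g \<Rightarrow> complex) set \<Rightarrow> 'g \<Rightarrow> complex" where
  "half_sum H \<Delta> = (\<lambda>x. (\<Sum>\<beta>\<in>positive_roots H \<Delta>. \<beta> x) / 2)"

end


section \<open>The exceptional types\<close>

datatype exceptional_type = G2 | F4 | E6 | E7 | E8

fun type_rank :: "exceptional_type \<Rightarrow> nat" where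
  "type_rank G2 = 2"
| "type_rank F4 = 4"
| "type_rank E6 = 6"
| "type_rank E7 = 7"
| "type_rank E8 = 8"

text \<open>
  Cartan matrices in Bourbaki's numbering, shifted to start at \<open>0\<close>: the entry in row \<open>i\<close>
  and column \<open>j\<close> is the value of the simple root \<open>\<alpha>\<^sub>i\<close> on the coroot of \<open>\<alpha>\<^sub>j\<close>.
\<close>

definition cartan_matrix_G2 :: "int list list" where
  "cartan_matrix_G2 =
    [[ 2, -1],
     [-3,  2]]"

definition cartan_matrix_F4 :: "int list list" where
  "cartan_matrix_F4 =
    [[ 2, -1,  0,  0],
     [-1,  2, -2,  0],
     [ 0, -1,  2, -1],
     [ 0,  0, -1,  2]]"

definition cartan_matrix_E8 :: "int list list" where
  "cartan_matrix_E8 =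
    [[ 2,  0, -1,  0,  0,  0,  0,  0],
     [ 0,  2,  0, -1,  0,  0,  0,  0],
     [-1,  0,  2, -1,  0,  0,  0,  0],
     [ 0, -1, -1,  2, -1,  0,  0,  0],
     [ 0,  0,  0, -1,  2, -1,  0,  0],
     [ 0,  0,  0,  0, -1,  2, -1,  0],
     [ 0,  0,  0,  0,  0, -1,  2, -1],
     [ 0,  0,  0,  0,  0,  0, -1,  2]]"

text \<open>\<open>E\<^sub>6\<close> and \<open>E\<^sub>7\<close> are given by the leading principal submatrices of the matrix of \<open>E\<^sub>8\<close>.\<close>

fun cartan_entry :: "exceptional_type \<Rightarrow> nat \<Rightarrow> nat \<Rightarrow> int" where
  "cartan_entry G2 i j = cartan_matrix_G2 ! i ! j"
| "cartan_entry F4 i j = cartan_matrix_F4 ! i ! j"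
| "cartan_entry E6 i j = cartan_matrix_E8 ! i ! j"
| "cartan_entry E7 i j = cartan_matrix_E8 ! i ! j"
| "cartan_entry E8 i j = cartan_matrix_E8 ! i ! j"

definition (in lie_algebra) has_type ::
  "'g set \<Rightarrow> ('g \<Rightarrow> complex) set \<Rightarrow> exceptional_type \<Rightarrow> bool" where
  "has_type H \<Delta> X \<longleftrightarrow>
     (\<exists>a. bij_betw a {..<type_rank X} \<Delta> \<and>
          (\<forall>i<type_rank X. \<forall>j<type_rank X.
             a i (coroot H (a j)) = of_int (cartan_entry X i j)))"


section \<open>Weyl group, Kostant's partition function, Weyl alternation sets\<close>

context lie_algebra
begin

definition reflection ::
  "'g set \<Rightarrow> ('g \<Rightarrow> complex) \<Rightarrow> ('g \<Rightarrow> complex) \<Rightarrow> ('g \<Rightarrow> complex)" where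
  "reflection H \<alpha> = (\<lambda>f\<in>dual H. (\<lambda>x. f x - f (coroot H \<alpha>) * \<alpha> x))"

definition weyl_group ::
  "'g set \<Rightarrow> ('g \<Rightarrow> complex) set \<Rightarrow> (('g \<Rightarrow> complex) \<Rightarrow> ('g \<Rightarrow> complex)) set" where
  "weyl_group H \<Delta> = generate (BijGroup (dual H)) (reflection H ` \<Delta>)"

definition kostant :: "'g set \<Rightarrow> ('g \<Rightarrow> complex) set \<Rightarrow> ('g \<Rightarrow> complex) \<Rightarrow> nat" where
  "kostant H \<Delta> \<xi> =
     card {m :: ('g \<Rightarrow> complex) \<Rightarrow> nat.
             (\<forall>\<beta>. \<beta> \<notin> positive_roots H \<Delta> \<longrightarrow> m \<beta> = 0) \<and>
             (\<forall>x. (\<Sum>\<beta>\<in>positive_roots H \<Delta>. of_nat (m \<beta>) * \<beta> x) = \<xi> x)}"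

definition weyl_alternation_set ::
  "'g set \<Rightarrow> ('g \<Rightarrow> complex) set \<Rightarrow> ('g \<Rightarrow> complex) \<Rightarrow> ('g \<Rightarrow> complex) \<Rightarrow>
     (('g \<Rightarrow> complex) \<Rightarrow> ('g \<Rightarrow> complex)) set" where
  "weyl_alternation_set H \<Delta> \<nu> \<mu> =
     {\<sigma> \<in> weyl_group H \<Delta>.
        kostant H \<Delta> (\<sigma> (\<nu> + half_sum H \<Delta>) - (\<mu> + half_sum H \<Delta>)) > 0}"

definition collapsed_weyl_alternation_set ::
  "'g set \<Rightarrow> ('g \<Rightarrow> complex) set \<Rightarrow> ('g \<Rightarrow> complex) \<Rightarrow> ('g \<Rightarrow> complex) \<Rightarrow>
     (('g \<Rightarrow> complex) \<Rightarrow> ('g \<Rightarrow> complex)) set" where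
  "collapsed_weyl_alternation_set H \<Delta> \<nu> \<mu> =
     {\<sigma> \<in> weyl_alternation_set H \<Delta> \<nu> \<mu>.
        \<not> (\<exists>\<alpha>\<in>\<Delta>.
             kostant H \<Delta> (\<sigma> (\<nu> + half_sum H \<Delta>) - half_sum H \<Delta> - \<mu>) =
             kostant H \<Delta> ((\<sigma> \<otimes>\<^bsub>BijGroup (dual H)\<^esub> reflection H \<alpha>) (\<nu> + half_sum H \<Delta>)
                              - half_sum H \<Delta> - \<mu>))}"

end

end

theory Submission
  imports Defs
begin

text \<open>
  Let \<open>\<nu>\<close> be the sum of the simple roots. In each exceptional type some column of the Cartan matrix
  sums to \<open>- 1\<close>, so \<open>\<nu>\<close> takes the value \<open>- 1\<close> on some simple coroot \<open>h\<close>. Since \<open>\<rho>\<close> takes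
  the value \<open>1\<close> on every simple coroot, \<open>(\<nu> + \<rho>)(h) = 0\<close> and the corresponding simple reflection \<open>s\<close>
  fixes \<open>\<nu> + \<rho>\<close>. Hence \<open>\<sigma>\<close> and \<open>\<sigma>s\<close> give the same value of the partition function for every
  \<open>\<sigma>\<close>, and no \<open>\<sigma>\<close> survives the collapse (\<open>collapsed_weyl_alternation_set_empty\<close>).

  The work lies in \<open>\<rho>(h) = 1\<close> (\<open>half_sum_on_simple_coroot\<close>), starting from the bare definition of a
  simple Lie algebra. It is obtained from traces only, without the representation theory of
  \<open>sl(2)\<close> and without the invariance of the root system under reflections: a commutator has trace \<open>0\<close>
  on every finite-dimensional space stable under both its factors, while the trace of \<open>h \<in> H\<close> on a
  space spanned by weight vectors is a sum of weights. This is applied to: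

  \<^item> a string of weight spaces in direction \<open>\<beta>\<close>: all weights take real multiples of the value
    \<open>\<beta>(h)\<close> on \<open>h = [x, y]\<close>, where \<open>x\<close> and \<open>y\<close> are vectors of weights \<open>\<beta>\<close> and \<open>- \<beta>\<close>
    (\<open>weight_real_multiple\<close>). This makes the Killing form nonzero, hence nondegenerate by simplicity,
    and so every root \<open>\<beta>\<close> has \<open>e\<close> and \<open>f\<close> of weights \<open>\<plusminus>\<beta>\<close> with \<open>\<beta>([e, f]) = 2\<close>
    (\<open>root_sl2_exists\<close>);
  \<^item> the span of \<open>f\<close>, \<open>H\<close> and the root spaces of the positive multiples of \<open>\<beta>\<close>: root spaces
    are one-dimensional (\<open>root_multiplicity_one\<close>), so the coroot is well defined and equals \<open>[e, f]\<close>;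
  \<^item> the span of \<open>f\<close>, \<open>H\<close> and all positive root spaces, for a simple root \<open>\<alpha>\<close>: here \<open>f\<close>
    contributes \<open>- 2\<close> and the positive roots contribute \<open>2\<rho>(h)\<close>, so \<open>\<rho>(h) = 1\<close>.
\<close>

section \<open>Eigenvectors and traces of linear maps\<close>

context vector_space
begin

text \<open>
  A stable subspace contains the eigencomponents of each of its vectors. Applying \<open>L - k\<close> removes the
  component for the eigenvalue \<open>k\<close> and rescales the others by nonzero factors.
\<close>

lemma eigen_components_in_subspace:
  assumes "finite S" and "subspace V" and L: "Vector_Spaces.linear scale scale L"
    and stable: "\<And>v. v \<in> V \<Longrightarrow> L v \<in> V"
    and "\<And>c. c \<in> S \<Longrightarrow> L (y c) = scale c (y c)" and "(\<Sum>c\<in>S. y c) \<in> V"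
  shows "\<forall>c\<in>S. y c \<in> V"
  using assms(1,5,6)
proof (induction S arbitrary: y rule: finite_induct)
  case empty
  then show ?case by simp
next
  case (insert k S)
  interpret L: Vector_Spaces.linear scale scale L by (rule L)
  let ?x = "\<Sum>c\<in>insert k S. y c"
  have "L ?x = (\<Sum>c\<in>insert k S. scale c (y c))"
    unfolding L.sum by (rule sum.cong[OF refl]) (rule insert.prems(1))
  then have "L ?x - scale k ?x = (\<Sum>c\<in>insert k S. scale (c - k) (y c))"
    by (simp only: scale_sum_right scale_left_diff_distrib sum_subtractf)
  also have "\<dots> = (\<Sum>c\<in>S. scale (c - k) (y c))"
    using insert.hyps by simp
  finally have "(\<Sum>c\<in>S. scale (c - k) (y c)) \<in> V"
    using subspace_diff[OF \<open>subspace V\<close> stable[OF insert.prems(2)]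
        subspace_scale[OF \<open>subspace V\<close> insert.prems(2), of k]] by simp
  moreover have "L (scale (c - k) (y c)) = scale c (scale (c - k) (y c))" if "c \<in> S" for c
    using that insert.prems(1) by (simp add: L.scale mult.commute)
  ultimately have *: "\<forall>c\<in>S. scale (c - k) (y c) \<in> V"
    by (intro insert.IH)
  have S: "y c \<in> V" if "c \<in> S" for c
  proof -
    have "c - k \<noteq> 0" using that insert.hyps by auto
    then show ?thesis
      using subspace_scale[OF \<open>subspace V\<close> *[rule_format, OF that], of "inverse (c - k)"] by simp
  qed
  have "y k = ?x - (\<Sum>c\<in>S. y c)"
    using insert.hyps by simp
  moreover have "(\<Sum>c\<in>S. y c) \<in> V"
    using S by (rule subspace_sum[OF \<open>subspace V\<close>])
  ultimately have "y k \<in> V"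
    using subspace_diff[OF \<open>subspace V\<close> insert.prems(2)] by simp
  with S show ?case by blast
qed

lemma span_eigenvectors_decompose:
  assumes L: "Vector_Spaces.linear scale scale L"
    and "x \<in> span {x. \<exists>c. L x = scale c x}"
  shows "\<exists>S y. finite S \<and> (\<forall>c\<in>S. L (y c) = scale c (y c)) \<and> x = (\<Sum>c\<in>S. y c)"
  using assms(2)
proof (induction rule: span_induct_alt)
  case base
  show ?case by (intro exI[of _ "{}"]) simp
next
  case (step a u v)
  interpret L: Vector_Spaces.linear scale scale L by (rule L)
  from step obtain k where k: "L u = scale k u" by blast
  from step obtain S y where S: "finite S" "\<forall>c\<in>S. L (y c) = scale c (y c)" "v = (\<Sum>c\<in>S. y c)"
    by blast
  define y' where "y' c = (if c \<in> S then y c else 0) + (if c = k then scale a u else 0)" for c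
  have "(\<Sum>c\<in>insert k S. y' c) = (\<Sum>c\<in>insert k S. if c \<in> S then y c else 0) + scale a u"
    using S(1) by (simp add: y'_def sum.distrib sum.delta del: sum.insert)
  also have "(\<Sum>c\<in>insert k S. if c \<in> S then y c else 0) = (\<Sum>c\<in>S. y c)"
    using S(1) by (intro sum.mono_neutral_cong_right) auto
  finally have "scale a u + v = (\<Sum>c\<in>insert k S. y' c)"
    using S(3) by (simp add: add.commute)
  moreover have "L (y' c) = scale c (y' c)" for c
    using S(2) k by (simp add: y'_def L.add L.scale scale_right_distrib mult.commute)
  ultimately show ?case
    using S(1) by (intro exI[of _ "insert k S"] exI[of _ y']) simp
qed

end

context lie_algebra
begin

text \<open>
  The trace of a linear map that preserves the span of the finite independent set \<open>B\<close>,
  read off in the basis \<open>B\<close> of that span.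
\<close>

definition trace_on :: "'g set \<Rightarrow> ('g \<Rightarrow> 'g) \<Rightarrow> complex" where
  "trace_on B L = (\<Sum>b\<in>B. representation B (L b) b)"

lemma trace_on_eigenbasis:
  assumes "independent B" and "\<And>b. b \<in> B \<Longrightarrow> L b = scale (d b) b"
  shows "trace_on B L = (\<Sum>b\<in>B. d b)"
  unfolding trace_on_def
  by (rule sum.cong) (simp_all add: assms representation_scale span_base representation_basis)

lemma trace_on_add:
  assumes "independent B" and "L ` B \<subseteq> span B" and "M ` B \<subseteq> span B"
  shows "trace_on B (\<lambda>v. L v + M v) = trace_on B L + trace_on B M"
  unfolding trace_on_def sum.distrib[symmetric]
  by (rule sum.cong) (use assms in \<open>auto simp: representation_add image_subset_iff\<close>)

lemma trace_on_diff:
  assumes "independent B" and "L ` B \<subseteq> span B" and "M ` B \<subseteq> span B"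
  shows "trace_on B (\<lambda>v. L v - M v) = trace_on B L - trace_on B M"
  unfolding trace_on_def sum_subtractf[symmetric]
  by (rule sum.cong) (use assms in \<open>auto simp: representation_diff image_subset_iff\<close>)

lemma trace_on_scale:
  assumes "independent B" and "L ` B \<subseteq> span B"
  shows "trace_on B (\<lambda>v. scale c (L v)) = c * trace_on B L"
  unfolding trace_on_def sum_distrib_left
  by (rule sum.cong) (use assms in \<open>auto simp: representation_scale image_subset_iff\<close>)

lemma trace_on_commute:
  assumes B: "independent B" "finite B"
    and L: "Vector_Spaces.linear scale scale L" "L ` B \<subseteq> span B"
    and M: "Vector_Spaces.linear scale scale M" "M ` B \<subseteq> span B"
  shows "trace_on B (\<lambda>v. L (M v)) = trace_on B (\<lambda>v. M (L v))"
proof -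
  let ?r = "representation B"
  have expand: "?r (P (Q b)) b = (\<Sum>b'\<in>B. ?r (Q b) b' * ?r (P b') b)"
    if P: "Vector_Spaces.linear scale scale P" "P ` B \<subseteq> span B" and Q: "Q ` B \<subseteq> span B"
      and b: "b \<in> B" for P Q b
  proof -
    interpret P: Vector_Spaces.linear scale scale P by (rule P)
    have "Q b = (\<Sum>b'\<in>B. scale (?r (Q b) b') b')"
      using sum_representation_eq[OF B(1) _ B(2) order_refl, of "Q b"] Q b by auto
    then have "P (Q b) = P (\<Sum>b'\<in>B. scale (?r (Q b) b') b')" by (rule arg_cong)
    also have "\<dots> = (\<Sum>b'\<in>B. scale (?r (Q b) b') (P b'))"
      by (simp only: P.sum P.scale)
    also have "?r \<dots> b = (\<Sum>b'\<in>B. ?r (scale (?r (Q b) b') (P b')) b)"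
      using P(2) B by (subst representation_sum) (auto intro: span_scale)
    also have "\<dots> = (\<Sum>b'\<in>B. ?r (Q b) b' * ?r (P b') b)"
      using P(2) B by (intro sum.cong) (auto simp: representation_scale)
    finally show ?thesis .
  qed
  have "trace_on B (\<lambda>v. L (M v)) = (\<Sum>b\<in>B. \<Sum>b'\<in>B. ?r (M b) b' * ?r (L b') b)"
    unfolding trace_on_def by (intro sum.cong refl expand[of L M] L M)
  also have "\<dots> = (\<Sum>b\<in>B. \<Sum>b'\<in>B. ?r (L b) b' * ?r (M b') b)"
    by (subst sum.swap) (simp add: mult.commute)
  also have "\<dots> = trace_on B (\<lambda>v. M (L v))"
    unfolding trace_on_def by (intro sum.cong refl expand[of M L, symmetric] L M)
  finally show ?thesis .
qed

end

section \<open>Joint diagonalization of a Cartan subalgebra\<close>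

context lie_algebra
begin

lemma bracket_add_right: "bracket x (y + z) = bracket x y + bracket x z"
  and bracket_scale_right: "bracket x (scale c y) = scale c (bracket x y)"
  and bracket_diff_right: "bracket x (y - z) = bracket x y - bracket x z"
  and bracket_zero_right: "bracket x 0 = 0"
  and bracket_sum_right: "bracket x (sum f A) = (\<Sum>a\<in>A. bracket x (f a))"
proof -
  interpret L: Vector_Spaces.linear scale scale "\<lambda>y. bracket x y" by (rule linear_right)
  show "bracket x (y + z) = bracket x y + bracket x z" by (rule L.add)
  show "bracket x (scale c y) = scale c (bracket x y)" by (rule L.scale)
  show "bracket x (y - z) = bracket x y - bracket x z" by (rule L.diff)
  show "bracket x 0 = 0" by (rule L.zero)
  show "bracket x (sum f A) = (\<Sum>a\<in>A. bracket x (f a))" by (rule L.sum)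
qed

lemma bracket_add_left: "bracket (x + y) z = bracket x z + bracket y z"
  and bracket_scale_left: "bracket (scale c x) z = scale c (bracket x z)"
  and bracket_zero_left: "bracket 0 z = 0"
proof -
  interpret L: Vector_Spaces.linear scale scale "\<lambda>x. bracket x z" by (rule linear_left)
  show "bracket (x + y) z = bracket x z + bracket y z" by (rule L.add)
  show "bracket (scale c x) z = scale c (bracket x z)" by (rule L.scale)
  show "bracket 0 z = 0" by (rule L.zero)
qed

lemma bracket_swap: "bracket y x = - bracket x y"
proof -
  have "0 = bracket x x + bracket y x + (bracket x y + bracket y y)"
    using alternating[of "x + y"] by (simp only: bracket_add_left bracket_add_right)
  then have "bracket x y + bracket y x = 0"
    by (simp add: alternating add.commute)
  then show ?thesis by (simp add: eq_neg_iff_add_eq_0 add.commute)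
qed

lemma bracket_minus_right: "bracket x (- y) = - bracket x y"
  using bracket_diff_right[of x 0 y] by (simp add: bracket_zero_right)

lemma bracket_bracket_left: "bracket (bracket x y) z = bracket x (bracket y z) - bracket y (bracket x z)"
proof -
  have "bracket z (bracket x y) = - bracket (bracket x y) z"
    "bracket y (bracket z x) = - bracket y (bracket x z)"
    by (rule bracket_swap) (simp only: bracket_swap[of z x] bracket_minus_right)
  then show ?thesis using jacobi[of x y z] by (simp add: algebra_simps eq_diff_eq)
qed

text \<open>
  Commuting diagonalizable operators are jointly diagonalizable: each joint eigenspace of \<open>F\<close> is stable
  under a further operator \<open>h\<close>, so it is spanned by eigenvectors of \<open>h\<close>.
\<close>

lemma span_joint_eigenvectors:
  assumes "finite F" and "\<forall>f\<in>F. ad_diagonalizable f" and "\<forall>f\<in>F. \<forall>g\<in>F. bracket f g = 0"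
  shows "span {x. \<forall>f\<in>F. \<exists>c. bracket f x = scale c x} = UNIV"
  using assms
proof (induction F rule: finite_induct)
  case empty
  then show ?case by simp
next
  case (insert h F)
  let ?E = "\<lambda>F. {x. \<forall>f\<in>F. \<exists>c. bracket f x = scale c x}"
  have "?E F \<subseteq> span (?E (insert h F))"
  proof
    fix x assume "x \<in> ?E F"
    then obtain e where e: "\<And>f. f \<in> F \<Longrightarrow> bracket f x = scale (e f) x"
      by simp metis
    define V where "V = {v. \<forall>f\<in>F. bracket f v = scale (e f) v}"
    have V: "subspace V"
      by (rule subspaceI)
         (auto simp: V_def bracket_add_right bracket_scale_right bracket_zero_right
           scale_right_distrib mult.commute)
    have stable: "bracket h v \<in> V" if "v \<in> V" for v
    proof -
      have "bracket f (bracket h v) = scale (e f) (bracket h v)" if f: "f \<in> F" for f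
        using bracket_bracket_left[of f h v] f \<open>v \<in> V\<close> insert.prems(2)
        by (simp add: V_def bracket_scale_right bracket_zero_left)
      then show ?thesis by (simp add: V_def)
    qed
    have "x \<in> span {x. \<exists>c. bracket h x = scale c x}"
      using insert.prems(1) by (simp add: ad_diagonalizable_def)
    then obtain S y where S: "finite S" "\<forall>c\<in>S. bracket h (y c) = scale c (y c)"
      "x = (\<Sum>c\<in>S. y c)"
      using span_eigenvectors_decompose[OF linear_right] by blast
    have "x \<in> V" using e by (simp add: V_def)
    then have "\<forall>c\<in>S. y c \<in> V"
      using eigen_components_in_subspace[OF S(1) V linear_right stable] S by blast
    then have "y c \<in> ?E (insert h F)" if "c \<in> S" for c
      using S(2) that by (auto simp: V_def)
    then show "x \<in> span (?E (insert h F))"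
      unfolding S(3) by (intro span_sum span_base)
  qed
  then have "span (?E F) \<subseteq> span (?E (insert h F))"
    by (rule span_minimal) simp
  then show ?case using insert by auto
qed

end

context simple_lie_algebra
begin

lemma independent_finite:
  assumes "independent B"
  shows "finite B"
proof -
  obtain A where "finite A" "span A = UNIV" using finite_dimensional by blast
  then show ?thesis using independent_span_bound[of A B] assms by simp
qed

lemma weight_basis_exists:
  assumes H: "cartan_subalgebra H"
  shows "\<exists>C w. independent C \<and> span C = UNIV \<and> (\<forall>c\<in>C. w c \<in> dual H \<and> c \<in> root_space H (w c))"
proof -
  have subH: "subspace H" using H by (simp add: cartan_subalgebra_def)
  obtain F where F: "F \<subseteq> H" "independent F" "H \<subseteq> span F"
    using maximal_independent_subset[of H] by blast
  define E where "E = {x. \<forall>f\<in>F. \<exists>c. bracket f x = scale c x}"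
  have E: "span E = UNIV"
    unfolding E_def
  proof (rule span_joint_eigenvectors)
    show "finite F" using F(2) by (rule independent_finite)
    show "\<forall>f\<in>F. ad_diagonalizable f" "\<forall>f\<in>F. \<forall>g\<in>F. bracket f g = 0"
      using H F(1) unfolding cartan_subalgebra_def by blast+
  qed
  obtain C where C: "C \<subseteq> E" "independent C" "E \<subseteq> span C"
    using maximal_independent_subset[of E] by blast
  have spanC: "span C = UNIV"
    using span_minimal[OF C(3) subspace_span] E by blast
  have eig: "\<exists>k. bracket h c = scale k c" if "h \<in> H" "c \<in> C" for h c
  proof -
    have "subspace {h. \<exists>k. bracket h c = scale k c}"
    proof (rule subspaceI)
      show "0 \<in> {h. \<exists>k. bracket h c = scale k c}"
        by (intro CollectI exI[of _ 0]) (simp add: bracket_zero_left)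
    next
      fix x y assume "x \<in> {h. \<exists>k. bracket h c = scale k c}" "y \<in> {h. \<exists>k. bracket h c = scale k c}"
      then obtain k l where "bracket x c = scale k c" "bracket y c = scale l c" by blast
      then have "bracket (x + y) c = scale (k + l) c"
        by (simp add: bracket_add_left scale_left_distrib)
      then show "x + y \<in> {h. \<exists>k. bracket h c = scale k c}" by blast
    next
      fix a x assume "x \<in> {h. \<exists>k. bracket h c = scale k c}"
      then obtain k where "bracket x c = scale k c" by blast
      then have "bracket (scale a x) c = scale (a * k) c"
        by (simp add: bracket_scale_left)
      then show "scale a x \<in> {h. \<exists>k. bracket h c = scale k c}" by blast
    qed
    moreover have "F \<subseteq> {h. \<exists>k. bracket h c = scale k c}"
      using C(1) \<open>c \<in> C\<close> by (auto simp: E_def)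
    ultimately have "span F \<subseteq> {h. \<exists>k. bracket h c = scale k c}"
      by (intro span_minimal)
    then show ?thesis using F(3) \<open>h \<in> H\<close> by blast
  qed
  define e where "e h c = (SOME k. bracket h c = scale k c)" for h c
  have e: "bracket h c = scale (e h c) c" if "h \<in> H" "c \<in> C" for h c
    unfolding e_def using eig[OF that] by (rule someI_ex)
  define w where "w c h = (if h \<in> H then e h c else 0)" for c h
  have "w c \<in> dual H \<and> c \<in> root_space H (w c)" if c: "c \<in> C" for c
  proof
    have "c \<noteq> 0" using C(2) c dependent_zero by metis
    show "w c \<in> dual H"
      unfolding dual_def
    proof (intro CollectI conjI ballI allI impI)
      fix x y assume xy: "x \<in> H" "y \<in> H"
      then have "x + y \<in> H" using subH subspace_add by blast
      then have "scale (e (x + y) c) c = scale (e x c + e y c) c"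
        using e[OF _ c, symmetric] xy by (simp add: bracket_add_left scale_left_distrib)
      then show "w c (x + y) = w c x + w c y"
        using xy \<open>x + y \<in> H\<close> \<open>c \<noteq> 0\<close> by (simp add: w_def)
    next
      fix k x assume x: "x \<in> H"
      then have "scale k x \<in> H" using subH subspace_scale by blast
      then have "scale (e (scale k x) c) c = scale (k * e x c) c"
        using e[OF _ c, of "scale k x"] e[OF x c] by (auto simp: bracket_scale_left)
      then show "w c (scale k x) = k * w c x"
        using x \<open>scale k x \<in> H\<close> \<open>c \<noteq> 0\<close> by (simp add: w_def)
    qed (simp add: w_def)
    show "c \<in> root_space H (w c)"
      using e c by (simp add: root_space_def w_def)
  qed
  with C(2) spanC show ?thesis by blast
qed

end

text \<open>
  A Cartan subalgebra \<open>H\<close> together with a basis \<open>C\<close> of joint eigenvectors of \<open>H\<close>;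
  the weight of the basis vector \<open>c\<close> is \<open>w c\<close>.
\<close>

locale cartan_weight_basis = simple_lie_algebra scale bracket
  for scale :: "complex \<Rightarrow> 'g::ab_group_add \<Rightarrow> 'g" and bracket :: "'g \<Rightarrow> 'g \<Rightarrow> 'g" +
  fixes H :: "'g set" and C :: "'g set" and w :: "'g \<Rightarrow> 'g \<Rightarrow> complex"
  assumes cartan: "cartan_subalgebra H"
    and C_independent: "independent C" and C_spans: "span C = UNIV"
    and weight_in_dual: "c \<in> C \<Longrightarrow> w c \<in> dual H"
    and weight_vector: "c \<in> C \<Longrightarrow> c \<in> root_space H (w c)"
begin

lemma subspace_H: "subspace H"
  using cartan by (simp add: cartan_subalgebra_def)

lemma C_finite: "finite C"
  using C_independent by (rule independent_finite)

lemma dual_add: "\<beta> \<in> dual H \<Longrightarrow> \<gamma> \<in> dual H \<Longrightarrow> \<beta> + \<gamma> \<in> dual H"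
  and dual_uminus: "\<beta> \<in> dual H \<Longrightarrow> - \<beta> \<in> dual H"
  and dual_zero: "0 \<in> dual H"
  and dual_mult: "\<beta> \<in> dual H \<Longrightarrow> (\<lambda>x. k * \<beta> x) \<in> dual H"
  by (auto simp: dual_def algebra_simps)

lemma dual_scale: "\<beta> \<in> dual H \<Longrightarrow> h \<in> H \<Longrightarrow> \<beta> (scale k h) = k * \<beta> h"
  by (auto simp: dual_def)

lemma dual_eqI:
  assumes "\<beta> \<in> dual H" "\<gamma> \<in> dual H" "\<And>h. h \<in> H \<Longrightarrow> \<beta> h = \<gamma> h"
  shows "\<beta> = \<gamma>"
proof
  fix x show "\<beta> x = \<gamma> x" using assms by (cases "x \<in> H") (auto simp: dual_def)
qed

lemma subspace_root_space: "subspace (root_space H \<beta>)"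
  by (rule subspaceI)
     (auto simp: root_space_def bracket_add_right bracket_scale_right bracket_zero_right
       scale_right_distrib mult.commute)

lemma root_space_zero: "root_space H 0 = H"
  using cartan by (auto simp: root_space_def cartan_subalgebra_def)

lemma bracket_root_space:
  assumes "x \<in> root_space H \<beta>" "y \<in> root_space H \<gamma>"
  shows "bracket x y \<in> root_space H (\<beta> + \<gamma>)"
  unfolding root_space_def
proof (intro CollectI ballI)
  fix h assume h: "h \<in> H"
  have "bracket (bracket h x) y = bracket h (bracket x y) - bracket x (bracket h y)"
    by (rule bracket_bracket_left)
  then show "bracket h (bracket x y) = scale ((\<beta> + \<gamma>) h) (bracket x y)"
    using assms h
    by (simp add: root_space_def bracket_scale_left bracket_scale_right scale_left_distrib
        diff_eq_eq eq_diff_eq)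
qed

lemma bracket_opposite_in_H:
  assumes "x \<in> root_space H \<beta>" "y \<in> root_space H (- \<beta>)"
  shows "bracket x y \<in> H"
  using bracket_root_space[OF assms] by (simp add: root_space_zero)

lemma root_space_eq_span:
  assumes "\<beta> \<in> dual H"
  shows "root_space H \<beta> = span {c\<in>C. w c = \<beta>}"
proof
  show "span {c\<in>C. w c = \<beta>} \<subseteq> root_space H \<beta>"
    using weight_vector by (intro span_minimal subspace_root_space) auto
  show "root_space H \<beta> \<subseteq> span {c\<in>C. w c = \<beta>}"
  proof
    fix x assume x: "x \<in> root_space H \<beta>"
    let ?r = "representation C x"
    have x_eq: "x = (\<Sum>c\<in>C. scale (?r c) c)"
      by (simp add: sum_representation_eq C_independent C_spans C_finite)
    have zero: "?r c = 0" if c: "c \<in> C" "w c \<noteq> \<beta>" for c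
    proof -
      obtain h where h: "h \<in> H" "w c h \<noteq> \<beta> h"
        using dual_eqI[OF weight_in_dual[OF c(1)] assms] c(2) by blast
      have "(\<Sum>c\<in>C. scale (?r c * w c h) c) = bracket h (\<Sum>c\<in>C. scale (?r c) c)"
        unfolding bracket_sum_right bracket_scale_right
        using weight_vector h(1) by (intro sum.cong) (auto simp: root_space_def)
      also have "\<dots> = scale (\<beta> h) (\<Sum>c\<in>C. scale (?r c) c)"
        using x h(1) unfolding x_eq[symmetric] by (simp add: root_space_def)
      finally have "(\<Sum>c\<in>C. scale (?r c * (w c h - \<beta> h)) c) = 0"
        by (simp add: right_diff_distrib scale_left_diff_distrib sum_subtractf scale_sum_right
            mult.commute)
      then have "?r c * (w c h - \<beta> h) = 0"
        using independentD[OF C_independent C_finite order_refl,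
            of "\<lambda>c. ?r c * (w c h - \<beta> h)" c] c(1) by simp
      then show ?thesis using h(2) by simp
    qed
    have "x = (\<Sum>c\<in>{c\<in>C. w c = \<beta>}. scale (?r c) c)"
      by (subst x_eq, rule sum.mono_neutral_right) (use C_finite zero in auto)
    also have "\<dots> \<in> span {c\<in>C. w c = \<beta>}"
      by (intro span_sum span_scale span_base)
    finally show "x \<in> span {c\<in>C. w c = \<beta>}" .
  qed
qed

lemma H_eq_span: "H = span {c\<in>C. w c = 0}"
  using root_space_eq_span[OF dual_zero] by (simp add: root_space_zero)

lemma bracket_weight_vector:
  assumes "\<beta> \<in> dual H" "x \<in> root_space H \<beta>" "c \<in> C"
  shows "bracket x c \<in> span {c'\<in>C. w c' = w c + \<beta>}"
  using bracket_root_space[OF assms(2) weight_vector[OF assms(3)]]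
    root_space_eq_span[OF dual_add[OF weight_in_dual[OF assms(3)] assms(1)]]
  by (simp add: add.commute)

lemma weight_vector_nonzero: "c \<in> C \<Longrightarrow> c \<noteq> 0"
  using C_independent dependent_zero by metis

lemma root_iff_weight: "\<beta> \<in> roots H \<longleftrightarrow> \<beta> \<noteq> 0 \<and> \<beta> \<in> w ` C"
proof
  assume \<beta>: "\<beta> \<in> roots H"
  then have "span {c\<in>C. w c = \<beta>} \<noteq> {0}"
    using root_space_eq_span by (auto simp: roots_def)
  then have "{c\<in>C. w c = \<beta>} \<noteq> {}" by (metis span_empty)
  then show "\<beta> \<noteq> 0 \<and> \<beta> \<in> w ` C" using \<beta> by (auto simp: roots_def)
next
  assume "\<beta> \<noteq> 0 \<and> \<beta> \<in> w ` C"
  then show "\<beta> \<in> roots H"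
    using weight_in_dual weight_vector weight_vector_nonzero by (auto simp: roots_def)
qed

lemma weight_vector_notin_span:
  assumes f: "f \<in> root_space H \<gamma>" "f \<noteq> 0" and \<gamma>: "\<gamma> \<in> dual H"
    and B: "B \<subseteq> {c\<in>C. w c \<noteq> \<gamma>}"
  shows "f \<notin> span B"
proof
    assume "f \<in> span B"
    moreover have f': "f \<in> span {c\<in>C. w c = \<gamma>}" using f root_space_eq_span[OF \<gamma>] by simp
    ultimately have eq: "representation C f = representation B f"
      "representation C f = representation {c\<in>C. w c = \<gamma>} f"
      using B by (intro representation_extend[OF C_independent]; auto)+
    have "representation C f c = 0" for c
    proof (rule ccontr)
      assume "representation C f c \<noteq> 0"
      then have "c \<in> B" "c \<in> {c\<in>C. w c = \<gamma>}"
        using representation_ne_zero[of B f c] representation_ne_zero[of "{c\<in>C. w c = \<gamma>}" f c]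
        unfolding eq(1)[symmetric] eq(2)[symmetric] by blast+
      then show False using B by blast
    qed
    then have "(\<Sum>c\<in>C. scale (representation C f c) c) = 0" by simp
    then show False
      using sum_representation_eq[OF C_independent _ C_finite order_refl, of f] C_spans f(2) by simp
qed

section \<open>Trace relations on weights\<close>

text \<open>
  The trace of \<open>[x, y]\<close> on a space stable under \<open>x\<close> and \<open>y\<close> is \<open>0\<close>; if \<open>[x, y]\<close> lies in \<open>H\<close>, it is
  also the sum of the weights of a basis of weight vectors.
\<close>

lemma sum_weights_on_commutator:
  assumes B: "independent B" "\<And>b. b \<in> B \<Longrightarrow> b \<in> root_space H (d b)"
    and x: "\<And>b. b \<in> B \<Longrightarrow> bracket x b \<in> span B"
    and y: "\<And>b. b \<in> B \<Longrightarrow> bracket y b \<in> span B"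
    and h: "bracket x y \<in> H"
  shows "(\<Sum>b\<in>B. d b (bracket x y)) = 0"
proof -
  have stable: "bracket u v \<in> span B" if "\<And>b. b \<in> B \<Longrightarrow> bracket u b \<in> span B" "v \<in> span B" for u v
    using that(2)
  proof (induction rule: span_induct_alt)
    case base
    then show ?case by (simp add: bracket_zero_right span_zero)
  next
    case (step c b v)
    then show ?case
      by (simp add: bracket_add_right bracket_scale_right span_add span_scale that(1))
  qed
  have "(\<Sum>b\<in>B. d b (bracket x y)) = trace_on B (bracket (bracket x y))"
    using B h by (intro trace_on_eigenbasis[symmetric]) (auto simp: root_space_def)
  also have "\<dots> = trace_on B (\<lambda>v. bracket x (bracket y v) - bracket y (bracket x v))"
    by (simp add: bracket_bracket_left[abs_def])
  also have "\<dots> = trace_on B (\<lambda>v. bracket x (bracket y v)) - trace_on B (\<lambda>v. bracket y (bracket x v))"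
    by (intro trace_on_diff B image_subsetI stable[of x, OF x] stable[of y, OF y] x y)
  also have "\<dots> = 0"
    using trace_on_commute[OF B(1) independent_finite[OF B(1)] linear_right _ linear_right, of x y] x y
    by auto
  finally show ?thesis .
qed

text \<open>
  The trace relation on the sum of the weight spaces for \<open>w c + k\<beta>\<close>, with \<open>k\<close> an integer. The multiple
  is in fact rational; being real makes its square nonnegative, which is what the Killing form needs.
\<close>

lemma weight_real_multiple:
  assumes \<beta>: "\<beta> \<in> dual H" and x: "x \<in> root_space H \<beta>" and y: "y \<in> root_space H (- \<beta>)"
    and c: "c \<in> C"
  shows "\<exists>r::real. w c (bracket x y) = of_real r * \<beta> (bracket x y)"
proof -
  let ?h = "bracket x y"
  define B where "B = {b\<in>C. \<exists>k::int. w b = w c + (\<lambda>h. of_int k * \<beta> h)}"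
  have "B \<subseteq> C" by (auto simp: B_def)
  then have finB: "finite B" using C_finite finite_subset by blast
  have cB: "c \<in> B" using c by (auto simp: B_def fun_eq_iff intro!: exI[of _ 0])
  have x_stable: "bracket x b \<in> span B" if b: "b \<in> B" for b
  proof -
    obtain k :: int where k: "w b = w c + (\<lambda>h. of_int k * \<beta> h)" using b by (auto simp: B_def)
    have "bracket x b \<in> span {c'\<in>C. w c' = w b + \<beta>}"
      using bracket_weight_vector[OF \<beta> x] b \<open>B \<subseteq> C\<close> by blast
    moreover have "{c'\<in>C. w c' = w b + \<beta>} \<subseteq> B"
      unfolding B_def k by (auto simp: fun_eq_iff algebra_simps intro!: exI[of _ "k + 1"])
    ultimately show ?thesis using span_mono by blast
  qed
  have y_stable: "bracket y b \<in> span B" if b: "b \<in> B" for b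
  proof -
    obtain k :: int where k: "w b = w c + (\<lambda>h. of_int k * \<beta> h)" using b by (auto simp: B_def)
    have "bracket y b \<in> span {c'\<in>C. w c' = w b + - \<beta>}"
      using bracket_weight_vector[OF dual_uminus[OF \<beta>] y] b \<open>B \<subseteq> C\<close> by blast
    moreover have "{c'\<in>C. w c' = w b + - \<beta>} \<subseteq> B"
      unfolding B_def k by (auto simp: fun_eq_iff algebra_simps intro!: exI[of _ "k - 1"])
    ultimately show ?thesis using span_mono by blast
  qed
  have "(\<Sum>b\<in>B. w b ?h) = 0"
    using \<open>B \<subseteq> C\<close> weight_vector x_stable y_stable bracket_opposite_in_H[OF x y]
    by (intro sum_weights_on_commutator independent_mono[OF C_independent]) auto
  moreover have "\<forall>b\<in>B. \<exists>k::int. w b = w c + (\<lambda>h. of_int k * \<beta> h)"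
    by (simp add: B_def)
  then obtain k :: "'g \<Rightarrow> int" where k: "\<forall>b\<in>B. w b = w c + (\<lambda>h. of_int (k b) * \<beta> h)"
    by (rule bchoice[THEN exE])
  have "(\<Sum>b\<in>B. w b ?h) = (\<Sum>b\<in>B. w c ?h + of_int (k b) * \<beta> ?h)"
    using k by (intro sum.cong refl) simp
  ultimately have "(\<Sum>b\<in>B. w c ?h + of_int (k b) * \<beta> ?h) = 0"
    by simp
  then have "of_nat (card B) * w c ?h = - of_int (\<Sum>b\<in>B. k b) * \<beta> ?h"
    by (simp add: sum.distrib sum_distrib_right eq_neg_iff_add_eq_0)
  moreover have "card B \<noteq> 0" using cB finB by auto
  ultimately have "w c ?h = of_real (- of_int (\<Sum>b\<in>B. k b) / of_nat (card B)) * \<beta> ?h"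
    by (simp add: field_simps)
  then show ?thesis by blast
qed

text \<open>An element of \<open>H\<close> on which all weights vanish is central, and the center is a proper ideal.\<close>

lemma cartan_element_eq_zero:
  assumes "h \<in> H" and "\<And>c. c \<in> C \<Longrightarrow> w c h = 0"
  shows "h = 0"
proof -
  let ?Z = "{z. \<forall>x. bracket x z = 0}"
  have "lie_ideal ?Z"
    unfolding lie_ideal_def
    by (auto intro!: subspaceI simp: bracket_add_right bracket_scale_right bracket_zero_right)
  moreover have "?Z \<noteq> UNIV" using nonabelian by blast
  ultimately have "?Z = {0}" using only_trivial_ideals by blast
  moreover have "bracket h x = 0" for x
  proof -
    have "x \<in> span C" by (simp add: C_spans)
    then show ?thesis
    proof (induction rule: span_induct_alt)
      case (step a c v)
      then have "bracket h c = 0"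
        using weight_vector[of c] assms by (simp add: root_space_def)
      with step show ?case by (simp add: bracket_add_right bracket_scale_right)
    qed (simp add: bracket_zero_right)
  qed
  then have "h \<in> ?Z" using bracket_swap[of _ h] by simp
  ultimately show ?thesis by blast
qed

lemma bracket_opposite_eq_zero:
  assumes \<beta>: "\<beta> \<in> dual H" and x: "x \<in> root_space H \<beta>" and y: "y \<in> root_space H (- \<beta>)"
    and "\<beta> (bracket x y) = 0"
  shows "bracket x y = 0"
  using weight_real_multiple[OF \<beta> x y] assms(4)
  by (intro cartan_element_eq_zero bracket_opposite_in_H[OF x y]) auto

section \<open>Nondegeneracy of the Killing form\<close>

text \<open>The Killing form; its trace is computed in the weight basis \<open>C\<close>.\<close>

definition killing :: "'g \<Rightarrow> 'g \<Rightarrow> complex" where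
  "killing x y = trace_on C (\<lambda>z. bracket x (bracket y z))"

lemma killing_add_right: "killing x (y + z) = killing x y + killing x z"
  unfolding killing_def bracket_add_left bracket_add_right
  by (rule trace_on_add[OF C_independent]) (simp_all add: C_spans)

lemma killing_scale_right: "killing x (scale k y) = k * killing x y"
  unfolding killing_def bracket_scale_left bracket_scale_right
  by (rule trace_on_scale[OF C_independent]) (simp add: C_spans)

lemma killing_zero_right: "killing x 0 = 0"
  using killing_scale_right[of x 0 0] by simp

lemma killing_commute: "killing x y = killing y x"
  unfolding killing_def
  by (rule trace_on_commute[OF C_independent C_finite linear_right _ linear_right])
     (simp_all add: C_spans)

lemma linear_bracket_bracket:
  "Vector_Spaces.linear scale scale (\<lambda>v. bracket x (bracket y v))"
  using Vector_Spaces.linear_compose[OF linear_right[of y] linear_right[of x]] by (simp add: comp_def)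

lemma killing_invariant: "killing (bracket x y) z = killing x (bracket y z)"
proof -
  have C: "L ` C \<subseteq> span C" for L by (simp add: C_spans)
  have "killing (bracket x y) z =
      trace_on C (\<lambda>v. bracket x (bracket y (bracket z v))) -
      trace_on C (\<lambda>v. bracket y (bracket x (bracket z v)))"
    unfolding killing_def bracket_bracket_left[of x y]
    by (rule trace_on_diff[OF C_independent C C])
  also have "trace_on C (\<lambda>v. bracket y (bracket x (bracket z v))) =
      trace_on C (\<lambda>v. bracket x (bracket z (bracket y v)))"
    by (rule trace_on_commute[OF C_independent C_finite linear_right C linear_bracket_bracket C])
  also have "trace_on C (\<lambda>v. bracket x (bracket y (bracket z v))) -
      trace_on C (\<lambda>v. bracket x (bracket z (bracket y v))) = killing x (bracket y z)"
    unfolding killing_def bracket_bracket_left[of y z] bracket_diff_right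
    by (rule trace_on_diff[OF C_independent C C, symmetric])
  finally show ?thesis .
qed

lemma killing_on_H:
  assumes "h \<in> H"
  shows "killing h h = (\<Sum>c\<in>C. (w c h)\<^sup>2)"
  unfolding killing_def
proof (rule trace_on_eigenbasis[OF C_independent])
  fix c assume "c \<in> C"
  then have "bracket h c = scale (w c h) c"
    using weight_vector assms by (simp add: root_space_def)
  then show "bracket h (bracket h c) = scale ((w c h)\<^sup>2) c"
    by (simp add: bracket_scale_right power2_eq_square)
qed

text \<open>
  If the Killing form vanished, opposite root spaces would commute by the real proportionality
  of weights, and the sum of the root spaces would be a nontrivial ideal.
\<close>

lemma killing_nonzero: "\<exists>x y. killing x y \<noteq> 0"
proof (rule ccontr)
  assume "\<not> (\<exists>x y. killing x y \<noteq> 0)"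
  then have vanish: "killing x y = 0" for x y by blast
  have commute: "bracket x y = 0"
    if b: "b \<in> C" and x: "x \<in> root_space H (w b)" and y: "y \<in> root_space H (- w b)" for b x y
  proof (rule bracket_opposite_eq_zero[OF weight_in_dual[OF b] x y], rule ccontr)
    let ?h = "bracket x y"
    assume nz: "w b ?h \<noteq> 0"
    define r where "r c = (SOME r::real. w c ?h = of_real r * w b ?h)" for c
    have r: "w c ?h = of_real (r c) * w b ?h" if "c \<in> C" for c
      unfolding r_def by (rule someI_ex) (rule weight_real_multiple[OF weight_in_dual[OF b] x y that])
    \<comment> \<open>The squared real multiples sum to \<open>0\<close>, although \<open>w b\<close> itself occurs with multiple \<open>1\<close>.\<close>
    have "killing ?h ?h = (\<Sum>c\<in>C. of_real ((r c)\<^sup>2) * (w b ?h)\<^sup>2)"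
      unfolding killing_on_H[OF bracket_opposite_in_H[OF x y]]
      by (rule sum.cong[OF refl], subst r) (simp_all add: power_mult_distrib)
    also have "\<dots> = of_real (\<Sum>c\<in>C. (r c)\<^sup>2) * (w b ?h)\<^sup>2"
      by (simp add: sum_distrib_right)
    finally have "of_real (\<Sum>c\<in>C. (r c)\<^sup>2) * (w b ?h)\<^sup>2 = 0"
      using vanish by simp
    then have "complex_of_real (\<Sum>c\<in>C. (r c)\<^sup>2) = 0"
      using nz by simp
    then have "(\<Sum>c\<in>C. (r c)\<^sup>2) = 0"
      unfolding of_real_eq_0_iff .
    then have "(r b)\<^sup>2 = 0"
      using b sum_nonneg_eq_0_iff[OF C_finite, of "\<lambda>c. (r c)\<^sup>2"] by simp
    then show False using r[OF b] nz by simp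
  qed
  define J where "J = span {c\<in>C. w c \<noteq> 0}"
  have basis_J: "bracket a c \<in> J" if a: "a \<in> C" and c: "c \<in> C" "w c \<noteq> 0" for a c
  proof (cases "w c + w a = 0")
    case True
    then have "w c = - w a" by (simp add: eq_neg_iff_add_eq_0)
    then have "bracket a c = 0"
      using weight_vector[OF c(1)] weight_vector[OF a] by (intro commute[OF a]) simp_all
    then show ?thesis by (simp add: J_def span_zero)
  next
    case False
    have "bracket a c \<in> span {c'\<in>C. w c' = w c + w a}"
      by (rule bracket_weight_vector[OF weight_in_dual[OF a] weight_vector[OF a] c(1)])
    also have "\<dots> \<subseteq> J"
      unfolding J_def using False by (intro span_mono) auto
    finally show ?thesis .
  qed
  have left_J: "bracket x c \<in> J" if c: "c \<in> C" "w c \<noteq> 0" for x c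
  proof -
    have "x \<in> span C" by (simp add: C_spans)
    then show ?thesis
    proof (induction rule: span_induct_alt)
      case base
      show ?case by (simp add: bracket_zero_left J_def span_zero)
    next
      case (step k a v)
      then show ?case
        using basis_J[OF step(1) c]
        by (simp add: bracket_add_left bracket_scale_left J_def span_add span_scale)
    qed
  qed
  have "bracket x y \<in> J" if "y \<in> J" for x y
    using that unfolding J_def
  proof (induction rule: span_induct_alt)
    case base
    show ?case by (simp add: bracket_zero_right span_zero)
  next
    case (step k c v)
    have "bracket x c \<in> span {c\<in>C. w c \<noteq> 0}"
      using left_J[of c x] step(1) by (simp add: J_def)
    then show ?case
      unfolding bracket_add_right bracket_scale_right by (intro span_add span_scale step.IH)
  qed
  then have "lie_ideal J" by (simp add: lie_ideal_def J_def)
  then consider "J = {0}" | "J = UNIV" using only_trivial_ideals by blast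
  then show False
  proof cases
    case 1
    then have "{c\<in>C. w c = 0} = C"
      using weight_vector_nonzero span_base[of _ "{c\<in>C. w c \<noteq> 0}"] by (auto simp: J_def)
    then have "H = UNIV" using H_eq_span C_spans by simp
    then show False using nonabelian cartan by (auto simp: cartan_subalgebra_def)
  next
    case 2
    have "w c \<noteq> 0" if "c \<in> C" for c
    proof
      assume "w c = 0"
      then have "J \<subseteq> span (C - {c})" unfolding J_def by (intro span_mono) auto
      then show False using 2 C_independent that unfolding dependent_def by blast
    qed
    then have "{c\<in>C. w c = 0} = {}" by blast
    then have "H = {0}" using H_eq_span by (metis span_empty)
    have "x = 0" for x :: 'g
    proof -
      have "\<forall>h\<in>H. bracket h x = 0" by (simp add: \<open>H = {0}\<close> bracket_zero_left)
      then have "x \<in> H" using cartan unfolding cartan_subalgebra_def by blast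
      then show ?thesis using \<open>H = {0}\<close> by blast
    qed
    then show False using nonabelian by blast
  qed
qed

lemma killing_nondegenerate:
  assumes "\<And>y. killing x y = 0"
  shows "x = 0"
proof -
  let ?R = "{x. \<forall>y. killing y x = 0}"
  have "killing y (bracket u x) = 0" if "\<forall>y. killing y x = 0" for u x y
    using killing_invariant[of y u x] that by simp
  then have "lie_ideal ?R"
    by (auto simp: lie_ideal_def killing_add_right killing_scale_right killing_zero_right
        intro!: subspaceI)
  moreover have "?R \<noteq> UNIV" using killing_nonzero by blast
  ultimately have "?R = {0}" using only_trivial_ideals by blast
  moreover have "x \<in> ?R" using assms killing_commute by auto
  ultimately show ?thesis by blast
qed

section \<open>Root spaces and coroots\<close>

lemma root_in_dual: "\<beta> \<in> roots H \<Longrightarrow> \<beta> \<in> dual H"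
  by (simp add: roots_def)

lemma dual_apply_zero: "\<beta> \<in> dual H \<Longrightarrow> \<beta> 0 = 0"
  using dual_scale[of \<beta> 0 0] subspace_0[OF subspace_H] by simp

text \<open>
  By invariance, a weight vector \<open>b\<close> of weight \<open>\<beta>\<close> can pair nontrivially under the Killing form only
  with a vector \<open>c\<close> of weight \<open>- \<beta>\<close>. Then \<open>[b, c] \<noteq> 0\<close>, because its pairing with \<open>h \<in> H\<close> is
  \<open>\<beta>(h)\<close> times that of \<open>b\<close> and \<open>c\<close>.
\<close>

lemma root_sl2_exists:
  assumes \<beta>: "\<beta> \<in> roots H"
  shows "\<exists>e\<in>root_space H \<beta>. \<exists>f\<in>root_space H (- \<beta>). \<beta> (bracket e f) = 2"
proof -
  note \<beta>d = root_in_dual[OF \<beta>]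
  obtain b where b: "b \<in> C" "w b = \<beta>" using \<beta> by (auto simp: root_iff_weight)
  have x: "b \<in> root_space H \<beta>" using weight_vector[OF b(1)] b(2) by simp
  obtain c where c: "c \<in> C" "killing b c \<noteq> 0"
  proof -
    have "killing b y = 0" if zero: "\<And>c. c \<in> C \<Longrightarrow> killing b c = 0" for y
    proof -
      have "y \<in> span C" by (simp add: C_spans)
      then show ?thesis
        by (induction rule: span_induct_alt)
           (simp_all add: killing_zero_right killing_add_right killing_scale_right zero)
    qed
    then have "\<exists>c\<in>C. killing b c \<noteq> 0"
      using killing_nondegenerate[of b] weight_vector_nonzero[OF b(1)] by metis
    then show ?thesis using that by blast
  qed
  have left: "killing h (bracket b c) = \<beta> h * killing b c" if "h \<in> H" for h
  proof -
    have "bracket h b = scale (\<beta> h) b" using x that by (simp add: root_space_def)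
    then have "killing h (bracket b c) = killing (scale (\<beta> h) b) c"
      using killing_invariant[of h b c] by simp
    also have "\<dots> = \<beta> h * killing c b"
      by (simp only: killing_commute[of _ c] killing_scale_right)
    finally show ?thesis by (simp only: killing_commute[of c b])
  qed
  have "w c h = - \<beta> h" if h: "h \<in> H" for h
  proof -
    have "killing h (bracket b c) = killing b (bracket c h)"
      by (simp only: killing_commute[of h "bracket b c"] killing_invariant)
    also have "bracket c h = scale (- w c h) c"
      using weight_vector[OF c(1)] h bracket_swap[of c h] by (simp add: root_space_def)
    finally have "\<beta> h * killing b c = - w c h * killing b c"
      using left[OF h] killing_scale_right[of b "- w c h" c] by simp
    then have "\<beta> h = - w c h" unfolding mult_right_cancel[OF c(2)] .
    then show ?thesis by simp
  qed
  then have wc: "w c = - \<beta>"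
    by (intro dual_eqI weight_in_dual[OF c(1)] dual_uminus[OF \<beta>d]) simp
  then have y: "c \<in> root_space H (- \<beta>)" using weight_vector[OF c(1)] by simp
  let ?t = "bracket b c"
  have tH: "?t \<in> H" by (rule bracket_opposite_in_H[OF x y])
  obtain h where h: "h \<in> H" "\<beta> h \<noteq> 0"
    using dual_eqI[OF \<beta>d dual_zero] \<beta> by (auto simp: roots_def)
  then have "killing h ?t \<noteq> 0" using left c(2) by simp
  then have "?t \<noteq> 0" using killing_zero_right by metis
  then have nz: "\<beta> ?t \<noteq> 0" using bracket_opposite_eq_zero[OF \<beta>d x y] by blast
  have "scale (2 / \<beta> ?t) b \<in> root_space H \<beta>"
    using x by (rule subspace_scale[OF subspace_root_space])
  moreover have "\<beta> (bracket (scale (2 / \<beta> ?t) b) c) = 2"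
    using nz by (simp add: bracket_scale_left dual_scale[OF \<beta>d tH])
  ultimately show ?thesis using y by blast
qed

text \<open>
  Let \<open>e\<close> and \<open>f\<close> have weights \<open>\<beta>\<close> and \<open>- \<beta>\<close>, with \<open>\<beta>(h) = 2\<close> for \<open>h = [e, f]\<close>. If the set
  of functionals \<open>P\<close> contains \<open>0\<close> but not \<open>- \<beta>\<close> and, as far as weights are concerned, is closed
  under adding \<open>\<beta>\<close> and, except at \<open>0\<close>, under subtracting \<open>\<beta>\<close>, then the span of \<open>f\<close> and of the
  weight spaces for \<open>P\<close> is stable under \<open>e\<close> and \<open>f\<close>: the bracket of \<open>f\<close> with the zero weight
  space \<open>H\<close> is a multiple of \<open>f\<close>. The trace of \<open>h\<close> on this space is \<open>0\<close>, and \<open>f\<close>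
  contributes \<open>- 2\<close>.
\<close>

lemma sum_weights_on_coroot:
  assumes \<beta>: "\<beta> \<in> dual H" and e: "e \<in> root_space H \<beta>" and f: "f \<in> root_space H (- \<beta>)"
    and two: "\<beta> (bracket e f) = 2"
    and P0: "0 \<in> P" and Pneg: "- \<beta> \<notin> P"
    and up: "\<And>c. c \<in> C \<Longrightarrow> w c \<in> P \<Longrightarrow> w c + \<beta> \<in> P"
    and down: "\<And>c c'. c \<in> C \<Longrightarrow> w c \<in> P \<Longrightarrow> w c \<noteq> 0 \<Longrightarrow> c' \<in> C \<Longrightarrow> w c' = w c - \<beta> \<Longrightarrow> w c' \<in> P"
  shows "(\<Sum>c | c \<in> C \<and> w c \<in> P. w c (bracket e f)) = 2"
proof -
  let ?h = "bracket e f" and ?B = "{c\<in>C. w c \<in> P}"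
  define B where "B = insert f ?B"
  define d where "d b = (if b = f then - \<beta> else w b)" for b
  have hH: "?h \<in> H" by (rule bracket_opposite_in_H[OF e f])
  have "f \<noteq> 0" using two dual_apply_zero[OF \<beta>] by (auto simp: bracket_zero_right)
  then have f_notin: "f \<notin> span ?B"
    using Pneg by (intro weight_vector_notin_span[OF f _ dual_uminus[OF \<beta>]]) auto
  have finB: "finite ?B" using C_finite by simp
  have subB: "span ?B \<subseteq> span B" unfolding B_def by (intro span_mono) blast
  have "(\<Sum>b\<in>B. d b ?h) = 0"
  proof (rule sum_weights_on_commutator[OF _ _ _ _ hH])
    show "independent B"
      unfolding B_def using f_notin independent_mono[OF C_independent, of ?B]
      by (intro independent_insertI) auto
    show "b \<in> root_space H (d b)" if "b \<in> B" for b
      using that f weight_vector by (auto simp: B_def d_def)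
    show "bracket e b \<in> span B" if "b \<in> B" for b
    proof (cases "b = f")
      case True
      have "H \<subseteq> span ?B" by (subst H_eq_span, rule span_mono) (use P0 in auto)
      then show ?thesis using hH subB True by blast
    next
      case False
      then have b: "b \<in> C" "w b \<in> P" using that by (auto simp: B_def)
      then have "bracket e b \<in> span {c'\<in>C. w c' = w b + \<beta>}"
        by (intro bracket_weight_vector[OF \<beta> e])
      also have "\<dots> \<subseteq> span ?B"
        by (rule span_mono) (use up[OF b] in auto)
      finally show ?thesis using subB by blast
    qed
    show "bracket f b \<in> span B" if b: "b \<in> B" for b
    proof -
      consider "b = f" | "b \<in> C" "w b \<in> P" "w b = 0" | "b \<in> C" "w b \<in> P" "w b \<noteq> 0"
        using b unfolding B_def by blast
      then show ?thesis
      proof cases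
        case 1
        then show ?thesis by (simp add: alternating span_zero)
      next
        case 2
        then have "b \<in> H" using weight_vector[of b] root_space_zero by simp
        then have "bracket f b = scale (\<beta> b) f"
          using bracket_swap[of f b] f by (simp add: root_space_def)
        then show ?thesis by (simp add: B_def span_scale span_base)
      next
        case 3
        then have "bracket f b \<in> span {c'\<in>C. w c' = w b + - \<beta>}"
          by (intro bracket_weight_vector[OF dual_uminus[OF \<beta>] f])
        also have "\<dots> \<subseteq> span ?B"
          by (rule span_mono) (use down[OF 3] in fastforce)
        finally show ?thesis using subB by blast
      qed
    qed
  qed
  moreover have "f \<notin> ?B" using f_notin span_base[of f ?B] by blast
  moreover from this have "(\<Sum>b\<in>?B. d b ?h) = (\<Sum>b\<in>?B. w b ?h)"
    by (intro sum.cong) (auto simp: d_def)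
  ultimately have "- \<beta> ?h + (\<Sum>b\<in>?B. w b ?h) = 0"
    using finB by (simp add: B_def d_def)
  then show ?thesis using two by simp
qed

text \<open>
  The previous relation for the multiples \<open>k\<beta>\<close> with \<open>k\<close> a natural number reads
  \<open>\<Sum>\<^sub>k 2k \<cdot> dim \<gg>\<^bsub>k\<beta>\<^esub> = 2\<close>.
\<close>

lemma root_multiplicity_one:
  assumes \<beta>: "\<beta> \<in> roots H" and "b \<in> C" "w b = \<beta>" "c \<in> C" "w c = \<beta>"
  shows "b = c"
proof -
  note \<beta>d = root_in_dual[OF \<beta>]
  obtain e f where e: "e \<in> root_space H \<beta>" and f: "f \<in> root_space H (- \<beta>)"
    and two: "\<beta> (bracket e f) = 2"
    using root_sl2_exists[OF \<beta>] by blast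
  let ?h = "bracket e f"
  define P where "P = range (\<lambda>k::nat. (\<lambda>x. of_nat k * \<beta> x))"
  have "- \<beta> \<notin> P"
  proof
    assume "- \<beta> \<in> P"
    then obtain k :: nat where "- \<beta> = (\<lambda>x. of_nat k * \<beta> x)" by (auto simp: P_def)
    from fun_cong[OF this] have "(- \<beta>) ?h = of_nat k * \<beta> ?h" .
    then have "of_nat (k + 1) = (0::complex)" using two by (simp add: field_simps)
    then show False by (simp only: of_nat_eq_0_iff)
  qed
  moreover have "0 \<in> P" by (auto simp: P_def fun_eq_iff intro!: image_eqI[of _ _ 0])
  moreover have "w c + \<beta> \<in> P" if "w c \<in> P" for c
  proof -
    from that obtain k :: nat where "w c = (\<lambda>x. of_nat k * \<beta> x)" by (auto simp: P_def)
    then have "w c + \<beta> = (\<lambda>x. of_nat (Suc k) * \<beta> x)" by (simp add: fun_eq_iff algebra_simps)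
    then show ?thesis unfolding P_def by (rule range_eqI)
  qed
  moreover have "w c - \<beta> \<in> P" if "w c \<in> P" "w c \<noteq> 0" for c
  proof -
    from that(1) obtain k :: nat where k: "w c = (\<lambda>x. of_nat k * \<beta> x)" by (auto simp: P_def)
    with that(2) obtain l where "k = Suc l" by (cases k) (auto simp: fun_eq_iff)
    with k have "w c - \<beta> = (\<lambda>x. of_nat l * \<beta> x)" by (simp add: fun_eq_iff algebra_simps)
    then show ?thesis unfolding P_def by (rule range_eqI)
  qed
  ultimately have trace: "(\<Sum>c | c \<in> C \<and> w c \<in> P. w c ?h) = 2"
    by (intro sum_weights_on_coroot[OF \<beta>d e f two]) simp_all
  define k :: "'g \<Rightarrow> nat" where "k c = (SOME k. w c = (\<lambda>x. of_nat k * \<beta> x))" for c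
  have k: "w c ?h = of_nat (2 * k c)" if "w c \<in> P" for c
  proof -
    have "\<exists>k::nat. w c = (\<lambda>x. of_nat k * \<beta> x)" using that by (auto simp: P_def)
    then have "w c = (\<lambda>x. of_nat (k c) * \<beta> x)" unfolding k_def by (rule someI_ex)
    from fun_cong[OF this] have "w c ?h = of_nat (k c) * \<beta> ?h" .
    then show ?thesis using two by simp
  qed
  have "(of_nat (\<Sum>c | c \<in> C \<and> w c \<in> P. 2 * k c) :: complex) = of_nat 2"
  proof -
    have "(of_nat (\<Sum>c | c \<in> C \<and> w c \<in> P. 2 * k c) :: complex) =
        (\<Sum>c | c \<in> C \<and> w c \<in> P. w c ?h)"
      unfolding of_nat_sum by (rule sum.cong[OF refl]) (use k in auto)
    then show ?thesis using trace by simp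
  qed
  then have "(\<Sum>c | c \<in> C \<and> w c \<in> P. 2 * k c) = 2"
    by (simp only: of_nat_eq_iff)
  then have sum_k: "(\<Sum>c | c \<in> C \<and> w c \<in> P. k c) = 1"
    by (simp flip: sum_distrib_left)
  have \<beta>P: "\<beta> \<in> P" by (auto simp: P_def fun_eq_iff intro!: image_eqI[of _ _ 1])
  have k1: "k c = 1" if "w c = \<beta>" for c
  proof -
    have "(of_nat (2 * k c) :: complex) = of_nat 2" using k[of c] \<beta>P that two by simp
    then show ?thesis by (simp only: of_nat_eq_iff)
  qed
  show "b = c"
  proof (rule ccontr)
    assume "b \<noteq> c"
    have "(\<Sum>c\<in>{b, c}. k c) \<le> (\<Sum>c | c \<in> C \<and> w c \<in> P. k c)"
      using assms \<beta>P C_finite by (intro sum_mono2) auto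
    then show False using \<open>b \<noteq> c\<close> sum_k k1 assms by simp
  qed
qed

lemma uminus_root:
  assumes "\<beta> \<in> roots H"
  shows "- \<beta> \<in> roots H"
proof -
  obtain e f where "f \<in> root_space H (- \<beta>)" "\<beta> (bracket e f) = 2"
    using root_sl2_exists[OF assms] by blast
  moreover from this have "f \<noteq> 0"
    using dual_apply_zero[OF root_in_dual[OF assms]] by (auto simp: bracket_zero_right)
  ultimately show ?thesis
    using assms dual_uminus by (auto simp: roots_def)
qed

lemma root_space_one_dimensional:
  assumes "\<beta> \<in> roots H"
  shows "\<exists>c. root_space H \<beta> = span {c}"
proof -
  obtain c where "c \<in> C" "w c = \<beta>" using assms by (auto simp: root_iff_weight)
  then have "{b\<in>C. w b = \<beta>} = {c}" using root_multiplicity_one[OF assms] by blast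
  then show ?thesis using root_space_eq_span[OF root_in_dual[OF assms]] by auto
qed

lemma coroot_is_bracket:
  assumes \<beta>: "\<beta> \<in> roots H"
  shows "\<exists>e\<in>root_space H \<beta>. \<exists>f\<in>root_space H (- \<beta>). bracket e f = coroot H \<beta> \<and> \<beta> (coroot H \<beta>) = 2"
proof -
  note \<beta>d = root_in_dual[OF \<beta>]
  obtain e f where e: "e \<in> root_space H \<beta>" and f: "f \<in> root_space H (- \<beta>)"
    and two: "\<beta> (bracket e f) = 2"
    using root_sl2_exists[OF \<beta>] by blast
  let ?S = "{bracket x y | x y. x \<in> root_space H \<beta> \<and> y \<in> root_space H (- \<beta>)}"
  obtain c d where c: "root_space H \<beta> = span {c}" and d: "root_space H (- \<beta>) = span {d}"
    using root_space_one_dimensional[OF \<beta>] root_space_one_dimensional[OF uminus_root[OF \<beta>]]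
    by blast
  let ?t = "bracket c d"
  have tH: "?t \<in> H"
    using c d by (intro bracket_opposite_in_H[of c \<beta>]) (simp_all add: span_base)
  have "?S \<subseteq> span {?t}"
    unfolding c d span_singleton by (auto simp: bracket_scale_left bracket_scale_right)
  then have S: "span ?S \<subseteq> span {?t}" by (rule span_minimal) simp
  have ef: "bracket e f \<in> span ?S" using e f by (intro span_base) blast
  have "h = bracket e f" if h: "h \<in> span ?S" "\<beta> h = 2" for h
  proof -
    obtain k l where k: "h = scale k ?t" and l: "bracket e f = scale l ?t"
      using S h(1) ef unfolding span_singleton by blast
    have "k * \<beta> ?t = 2" "l * \<beta> ?t = 2"
      using h(2) two k l dual_scale[OF \<beta>d tH] by simp_all
    then have "k = l" by (metis mult_cancel_right mult_zero_right zero_neq_numeral)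
    then show ?thesis using k l by simp
  qed
  then have "coroot H \<beta> = bracket e f"
    unfolding coroot_def using ef two by (intro the_equality) blast+
  then show ?thesis using e f two by metis
qed

end

section \<open>The half sum of positive roots on simple coroots\<close>

lemma sum_fun_apply: "(\<Sum>a\<in>A. f a) x = (\<Sum>a\<in>A. f a x)"
  by (induction A rule: infinite_finite_induct) simp_all

context cartan_weight_basis
begin

lemma root_base_independent:
  assumes \<Delta>: "root_base H \<Delta>" and zero: "\<And>x. (\<Sum>\<beta>\<in>\<Delta>. u \<beta> * \<beta> x) = 0" and "\<alpha> \<in> \<Delta>"
  shows "u \<alpha> = 0"
proof -
  interpret M: module "\<lambda>(c::complex) (f::'g \<Rightarrow> complex) x. c * f x"
    by standard (simp_all add: fun_eq_iff algebra_simps)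
  have "(\<Sum>\<beta>\<in>\<Delta>. (\<lambda>x. u \<beta> * \<beta> x)) = 0"
    using zero by (simp add: fun_eq_iff sum_fun_apply)
  then show ?thesis
    using \<Delta> \<open>\<alpha> \<in> \<Delta>\<close> M.independentD[of \<Delta> \<Delta> u \<alpha>] by (simp add: root_base_def)
qed

lemma sum_indicator_root:
  assumes "finite \<Delta>" "\<alpha> \<in> \<Delta>"
  shows "(\<Sum>\<beta>\<in>\<Delta>. of_nat (if \<beta> = \<alpha> then 1 else 0) * \<beta> x) = (\<alpha> x :: complex)"
proof -
  have "(\<Sum>\<beta>\<in>\<Delta>. of_nat (if \<beta> = \<alpha> then 1 else 0) * \<beta> x) = (\<Sum>\<beta>\<in>\<Delta>. if \<beta> = \<alpha> then \<beta> x else 0)"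
    by (rule sum.cong) auto
  then show ?thesis using assms by simp
qed

text \<open>
  The trace relation for the nonnegative combinations of the base. As \<open>\<alpha>\<close> is simple, subtracting it
  from a positive root gives \<open>0\<close>, a positive root, or no weight.
\<close>

lemma half_sum_on_simple_coroot:
  assumes \<Delta>: "root_base H \<Delta>" and \<alpha>: "\<alpha> \<in> \<Delta>"
  shows "half_sum H \<Delta> (coroot H \<alpha>) = 1"
proof -
  have fin: "finite \<Delta>" and \<alpha>_root: "\<alpha> \<in> roots H"
    and sign: "\<And>\<beta>. \<beta> \<in> roots H \<Longrightarrow> nonneg_combination \<Delta> \<beta> \<or> nonneg_combination \<Delta> (- \<beta>)"
    using \<Delta> \<alpha> by (auto simp: root_base_def)
  define \<delta> :: "('g \<Rightarrow> complex) \<Rightarrow> nat" where "\<delta> \<beta> = (if \<beta> = \<alpha> then 1 else 0)" for \<beta>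
  have \<delta>: "(\<Sum>\<beta>\<in>\<Delta>. of_nat (\<delta> \<beta>) * \<beta> x) = \<alpha> x" for x
    unfolding \<delta>_def by (rule sum_indicator_root[OF fin \<alpha>])
  obtain e f where ef: "e \<in> root_space H \<alpha>" "f \<in> root_space H (- \<alpha>)"
    "bracket e f = coroot H \<alpha>" "\<alpha> (coroot H \<alpha>) = 2"
    using coroot_is_bracket[OF \<alpha>_root] by blast
  let ?h = "coroot H \<alpha>"
  define P where "P = {\<beta>. nonneg_combination \<Delta> \<beta>}"
  have P0: "0 \<in> P"
    by (auto simp: P_def nonneg_combination_def intro!: exI[of _ "\<lambda>_. 0"])
  have Pneg: "- \<alpha> \<notin> P"
  proof
    assume "- \<alpha> \<in> P"
    then obtain k :: "('g \<Rightarrow> complex) \<Rightarrow> nat" where k: "\<And>x. - \<alpha> x = (\<Sum>\<beta>\<in>\<Delta>. of_nat (k \<beta>) * \<beta> x)"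
      by (auto simp: P_def nonneg_combination_def)
    have "(\<Sum>\<beta>\<in>\<Delta>. of_nat (k \<beta> + \<delta> \<beta>) * \<beta> x) = 0" for x
      by (simp add: distrib_right sum.distrib \<delta> flip: k)
    then have "(of_nat (k \<alpha> + \<delta> \<alpha>) :: complex) = 0"
      by (rule root_base_independent[OF \<Delta> _ \<alpha>])
    then show False by (simp only: of_nat_eq_0_iff) (simp add: \<delta>_def)
  qed
  have up: "\<beta> + \<alpha> \<in> P" if \<beta>: "\<beta> \<in> P" for \<beta>
  proof -
    obtain k :: "('g \<Rightarrow> complex) \<Rightarrow> nat" where "\<And>x. \<beta> x = (\<Sum>\<gamma>\<in>\<Delta>. of_nat (k \<gamma>) * \<gamma> x)"
      using \<beta> by (auto simp: P_def nonneg_combination_def)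
    then have "(\<beta> + \<alpha>) x = (\<Sum>\<gamma>\<in>\<Delta>. of_nat (k \<gamma> + \<delta> \<gamma>) * \<gamma> x)" for x
      by (simp add: distrib_right sum.distrib \<delta>)
    then show ?thesis
      unfolding P_def nonneg_combination_def by (intro CollectI exI[of _ "\<lambda>\<gamma>. k \<gamma> + \<delta> \<gamma>"]) simp
  qed
  have down: "w c' \<in> P"
    if c: "w c \<in> P" "w c \<noteq> 0" and c': "c' \<in> C" "w c' = w c - \<alpha>" for c c'
  proof (rule ccontr)
    assume neg: "w c' \<notin> P"
    then have "w c' \<noteq> 0" using P0 by metis
    then have "w c' \<in> roots H" using c'(1) by (simp add: root_iff_weight)
    then have "nonneg_combination \<Delta> (- w c')" using sign neg by (auto simp: P_def)
    then obtain m :: "('g \<Rightarrow> complex) \<Rightarrow> nat"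
      where m: "\<And>x. - w c' x = (\<Sum>\<gamma>\<in>\<Delta>. of_nat (m \<gamma>) * \<gamma> x)"
      by (auto simp: nonneg_combination_def)
    obtain k :: "('g \<Rightarrow> complex) \<Rightarrow> nat" where k: "\<And>x. w c x = (\<Sum>\<gamma>\<in>\<Delta>. of_nat (k \<gamma>) * \<gamma> x)"
      using c(1) by (auto simp: P_def nonneg_combination_def)
    \<comment> \<open>Both \<open>w c\<close> and \<open>\<alpha> - w c\<close> are nonnegative combinations, and \<open>\<alpha>\<close> is simple, so one of them is \<open>0\<close>.\<close>
    have "(\<Sum>\<gamma>\<in>\<Delta>. (of_nat (k \<gamma> + m \<gamma>) - of_nat (\<delta> \<gamma>)) * \<gamma> x) = 0" for x
      using c'(2) by (simp add: distrib_right left_diff_distrib sum.distrib sum_subtractf \<delta> flip: k m)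
    then have "(of_nat (k \<gamma> + m \<gamma>) - of_nat (\<delta> \<gamma>) :: complex) = 0" if "\<gamma> \<in> \<Delta>" for \<gamma>
      using that by (rule root_base_independent[OF \<Delta>])
    then have "(of_nat (k \<gamma> + m \<gamma>) :: complex) = of_nat (\<delta> \<gamma>)" if "\<gamma> \<in> \<Delta>" for \<gamma>
      using that by simp
    then have km: "k \<gamma> + m \<gamma> = \<delta> \<gamma>" if "\<gamma> \<in> \<Delta>" for \<gamma>
      using that by (simp only: of_nat_eq_iff)
    have "k \<alpha> = 0 \<or> m \<alpha> = 0" using km[OF \<alpha>] by (auto simp: \<delta>_def)
    then have "(\<forall>\<gamma>\<in>\<Delta>. k \<gamma> = 0) \<or> (\<forall>\<gamma>\<in>\<Delta>. m \<gamma> = 0)"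
      using km by (metis \<delta>_def add_eq_0_iff_both_eq_0)
    then show False
    proof
      assume "\<forall>\<gamma>\<in>\<Delta>. k \<gamma> = 0"
      then have "w c = 0" by (simp add: fun_eq_iff k)
      then show False using c(2) by simp
    next
      assume "\<forall>\<gamma>\<in>\<Delta>. m \<gamma> = 0"
      then have "- w c' x = 0" for x by (simp add: m)
      then have "w c' = 0" by (simp add: fun_eq_iff)
      then show False using \<open>w c' \<noteq> 0\<close> by simp
    qed
  qed
  have trace: "(\<Sum>c | c \<in> C \<and> w c \<in> P. w c ?h) = 2"
    unfolding ef(3)[symmetric]
  proof (rule sum_weights_on_coroot[OF root_in_dual[OF \<alpha>_root] ef(1,2) _ P0 Pneg])
    show "\<alpha> (bracket e f) = 2" using ef(3,4) by simp
    show "w c + \<alpha> \<in> P" if "w c \<in> P" for c using that by (rule up)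
    show "w c' \<in> P" if "w c \<in> P" "w c \<noteq> 0" "c' \<in> C" "w c' = w c - \<alpha>" for c c'
      using that by (rule down)
  qed
  let ?C = "{c\<in>C. w c \<noteq> 0 \<and> w c \<in> P}"
  have pos: "positive_roots H \<Delta> = w ` ?C"
    by (auto simp: positive_roots_def root_iff_weight P_def)
  have inj: "inj_on w ?C"
    by (rule inj_onI) (use root_multiplicity_one root_iff_weight in auto)
  have "(\<Sum>\<beta>\<in>positive_roots H \<Delta>. \<beta> ?h) = (\<Sum>c\<in>?C. w c ?h)"
    unfolding pos by (simp add: sum.reindex[OF inj])
  also have "\<dots> = (\<Sum>c | c \<in> C \<and> w c \<in> P. w c ?h)"
    using C_finite by (intro sum.mono_neutral_left) auto
  finally show ?thesis by (simp add: half_sum_def trace)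
qed

lemma half_sum_in_dual: "half_sum H \<Delta> \<in> dual H"
proof -
  have \<beta>: "\<beta> \<in> dual H" if "\<beta> \<in> positive_roots H \<Delta>" for \<beta>
    using that by (simp add: positive_roots_def roots_def)
  have "(\<Sum>\<beta>\<in>positive_roots H \<Delta>. \<beta> (x + y)) =
      (\<Sum>\<beta>\<in>positive_roots H \<Delta>. \<beta> x) + (\<Sum>\<beta>\<in>positive_roots H \<Delta>. \<beta> y)"
    if "x \<in> H" "y \<in> H" for x y
    unfolding sum.distrib[symmetric] by (rule sum.cong) (use \<beta> that in \<open>auto simp: dual_def\<close>)
  moreover have "(\<Sum>\<beta>\<in>positive_roots H \<Delta>. \<beta> (scale c x)) = c * (\<Sum>\<beta>\<in>positive_roots H \<Delta>. \<beta> x)"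
    if "x \<in> H" for c x
    unfolding sum_distrib_left by (rule sum.cong) (use \<beta> that in \<open>auto simp: dual_def\<close>)
  moreover have "(\<Sum>\<beta>\<in>positive_roots H \<Delta>. \<beta> x) = 0" if "x \<notin> H" for x
    by (rule sum.neutral) (use \<beta> that in \<open>auto simp: dual_def\<close>)
  ultimately show ?thesis
    by (simp add: dual_def half_sum_def add_divide_distrib)
qed

lemma dual_sum: "(\<And>\<beta>. \<beta> \<in> A \<Longrightarrow> \<beta> \<in> dual H) \<Longrightarrow> (\<Sum>\<beta>\<in>A. \<beta>) \<in> dual H"
  by (induction A rule: infinite_finite_induct) (auto simp: dual_zero dual_add)

section \<open>Collapse of the alternation set\<close>

lemma reflection_in_Bij:
  assumes \<alpha>: "\<alpha> \<in> roots H"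
  shows "reflection H \<alpha> \<in> Bij (dual H)"
proof -
  let ?s = "reflection H \<alpha>"
  have two: "\<alpha> (coroot H \<alpha>) = 2" using coroot_is_bracket[OF \<alpha>] by blast
  have s: "?s f = (\<lambda>x. f x - f (coroot H \<alpha>) * \<alpha> x)" if "f \<in> dual H" for f
    using that by (simp add: reflection_def)
  have closed: "?s f \<in> dual H" if f: "f \<in> dual H" for f
  proof -
    have "f + - (\<lambda>x. f (coroot H \<alpha>) * \<alpha> x) \<in> dual H"
      by (intro dual_add dual_uminus dual_mult f root_in_dual[OF \<alpha>])
    moreover have "?s f = f + - (\<lambda>x. f (coroot H \<alpha>) * \<alpha> x)"
      by (simp add: s[OF f] fun_eq_iff)
    ultimately show ?thesis by simp
  qed
  moreover have "?s (?s f) = f" if f: "f \<in> dual H" for f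
    unfolding s[OF closed[OF f]] by (simp add: s[OF f] two fun_eq_iff algebra_simps)
  ultimately have "bij_betw ?s (dual H) (dual H)"
    by (intro bij_betwI[where g = ?s]) auto
  moreover have "?s \<in> extensional (dual H)" by (simp add: reflection_def)
  ultimately show ?thesis by (simp add: Bij_def)
qed

text \<open>
  If \<open>\<nu>\<close> pairs to \<open>- 1\<close> with a simple coroot, then \<open>\<nu> + \<rho>\<close> pairs to \<open>0\<close> with it, so the
  simple reflection fixes \<open>\<nu> + \<rho>\<close> and right multiplication by it changes no partition value.
\<close>

lemma collapsed_weyl_alternation_set_empty:
  assumes \<Delta>: "root_base H \<Delta>" and \<alpha>: "\<alpha> \<in> \<Delta>"
    and \<nu>: "\<nu> \<in> dual H" "\<nu> (coroot H \<alpha>) = - 1"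
  shows "collapsed_weyl_alternation_set H \<Delta> \<nu> \<mu> = {}"
proof -
  let ?G = "BijGroup (dual H)" and ?v = "\<nu> + half_sum H \<Delta>"
  have roots: "\<Delta> \<subseteq> roots H" using \<Delta> by (simp add: root_base_def)
  have v: "?v \<in> dual H" using \<nu>(1) half_sum_in_dual by (rule dual_add)
  have "?v (coroot H \<alpha>) = 0"
    using half_sum_on_simple_coroot[OF \<Delta> \<alpha>] \<nu>(2) by simp
  then have fixed: "reflection H \<alpha> ?v = ?v"
    using v by (simp add: reflection_def fun_eq_iff)
  have eq: "(\<sigma> \<otimes>\<^bsub>?G\<^esub> reflection H \<alpha>) ?v = \<sigma> ?v" if "\<sigma> \<in> weyl_group H \<Delta>" for \<sigma>
  proof -
    have carrier: "reflection H ` \<Delta> \<subseteq> carrier ?G"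
      using roots reflection_in_Bij by (auto simp: BijGroup_def)
    have "\<sigma> \<in> carrier ?G"
      using group.generate_in_carrier[OF group_BijGroup carrier] that by (simp add: weyl_group_def)
    then have "\<sigma> \<otimes>\<^bsub>?G\<^esub> reflection H \<alpha> = compose (dual H) \<sigma> (reflection H \<alpha>)"
      using reflection_in_Bij roots \<alpha> by (auto simp: BijGroup_def)
    then show ?thesis using v fixed by (simp add: compose_def)
  qed
  have "\<exists>\<alpha>\<in>\<Delta>. kostant H \<Delta> (\<sigma> ?v - half_sum H \<Delta> - \<mu>) =
      kostant H \<Delta> ((\<sigma> \<otimes>\<^bsub>?G\<^esub> reflection H \<alpha>) ?v - half_sum H \<Delta> - \<mu>)"
    if "\<sigma> \<in> weyl_group H \<Delta>" for \<sigma>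
    by (rule bexI[OF _ \<alpha>]) (simp only: eq[OF that])
  then show ?thesis
    unfolding collapsed_weyl_alternation_set_def weyl_alternation_set_def by blast
qed

end

text \<open>
  The column is that of the short simple root at the multiple bond for \<open>G\<^sub>2\<close> and \<open>F\<^sub>4\<close>, and that of
  the trivalent node for \<open>E\<^sub>6\<close>, \<open>E\<^sub>7\<close> and \<open>E\<^sub>8\<close>.
\<close>

lemma cartan_column_sum:
  "\<exists>j<type_rank X. (\<Sum>i<type_rank X. cartan_entry X i j) = - 1"
proof (cases X)
  case G2
  then show ?thesis
    by (intro exI[of _ 0]) (simp add: lessThan_nat_numeral lessThan_Suc cartan_matrix_G2_def numeral_eq_Suc)
next
  case F4
  then show ?thesis
    by (intro exI[of _ 2]) (simp add: lessThan_nat_numeral lessThan_Suc cartan_matrix_F4_def numeral_eq_Suc)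
next
  case E6
  then show ?thesis
    by (intro exI[of _ 3]) (simp add: lessThan_nat_numeral lessThan_Suc cartan_matrix_E8_def numeral_eq_Suc)
next
  case E7
  then show ?thesis
    by (intro exI[of _ 3]) (simp add: lessThan_nat_numeral lessThan_Suc cartan_matrix_E8_def numeral_eq_Suc)
next
  case E8
  then show ?thesis
    by (intro exI[of _ 3]) (simp add: lessThan_nat_numeral lessThan_Suc cartan_matrix_E8_def numeral_eq_Suc)
qed

theorem theorem6p1:
  fixes scale :: "complex \<Rightarrow> 'g::ab_group_add \<Rightarrow> 'g"
    and bracket :: "'g \<Rightarrow> 'g \<Rightarrow> 'g"
    and H :: "'g set"
    and \<Delta> :: "('g \<Rightarrow> complex) set"
    and X :: exceptional_type
  assumes "simple_lie_algebra scale bracket"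
    and "lie_algebra.cartan_subalgebra scale bracket H"
    and "lie_algebra.root_base scale bracket H \<Delta>"
    and "lie_algebra.has_type scale bracket H \<Delta> X"
  shows "lie_algebra.collapsed_weyl_alternation_set scale bracket H \<Delta> (\<Sum>\<alpha>\<in>\<Delta>. \<alpha>) 0 = {}"
proof -
  interpret simple_lie_algebra scale bracket by (rule assms(1))
  obtain C w where "independent C" "span C = UNIV"
    "\<forall>c\<in>C. w c \<in> dual H \<and> c \<in> root_space H (w c)"
    using weight_basis_exists[OF assms(2)] by blast
  then interpret cartan_weight_basis scale bracket H C w
    using assms(2) by unfold_locales auto
  obtain a where a: "bij_betw a {..<type_rank X} \<Delta>"
    and entry: "\<forall>i<type_rank X. \<forall>j<type_rank X. a i (coroot H (a j)) = of_int (cartan_entry X i j)"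
    using assms(4) unfolding has_type_def by blast
  obtain j where j: "j < type_rank X" "(\<Sum>i<type_rank X. cartan_entry X i j) = - 1"
    using cartan_column_sum by blast
  show ?thesis
  proof (rule collapsed_weyl_alternation_set_empty[OF assms(3)])
    show "a j \<in> \<Delta>" using a j(1) by (auto simp: bij_betw_def)
    show "(\<Sum>\<alpha>\<in>\<Delta>. \<alpha>) \<in> dual H"
      using assms(3) by (intro dual_sum) (auto simp: root_base_def roots_def)
    have "(\<Sum>\<alpha>\<in>\<Delta>. \<alpha>) (coroot H (a j)) = (\<Sum>i<type_rank X. a i (coroot H (a j)))"
      unfolding sum_fun_apply by (rule sum.reindex_bij_betw[OF a, symmetric])
    also have "\<dots> = of_int (\<Sum>i<type_rank X. cartan_entry X i j)"
      unfolding of_int_sum using entry j(1) by (intro sum.cong) auto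
    finally show "(\<Sum>\<alpha>\<in>\<Delta>. \<alpha>) (coroot H (a j)) = - 1"
      using j(2) by simp
  qed
qed

end
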